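(* Let $v$, $k$ and $\lambda$ be positive integers such that $3 \leq k < v$, and let $r$ and $d$ be the integers such that $\lambda(v-1)=r(k-1)-d$ and $0 \leq d < k-1$. If $d < r-\lambda$, then $$C_{\lambda}(v,k) \geq \left\lceil\frac{v(r+1)}{k+1}\right\rceil.$$
   Context: A $(v,k,\lambda)$-covering is a pair $(V,\mathcal{B})$ where $V$ is a set of $v$ points and $\mathcal{B}$ is a collection (multiset allowed) of $k$-subsets of $V$ (blocks) such that every pair of distinct points lies together in at least $\lambda$ blocks. The covering number $C_\lambda(v,k)$ is the minimum number of blocks in a $(v,k,\lambda)$-covering. *)

theory Defs
  imports Complex_Main "HOL-Library.Multiset"
begin

definition is_covering :: "nat \<Rightarrow> nat \<Rightarrow> nat \<Rightarrow> 'a set \<Rightarrow> 'a set multiset \<Rightarrow> bool" where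
  "is_covering v k lam V \<B> \<longleftrightarrow>
     finite V \<and> card V = v \<and>
     (\<forall>b \<in># \<B>. b \<subseteq> V \<and> card b = k) \<and>
     (\<forall>x \<in> V. \<forall>y \<in> V. x \<noteq> y \<longrightarrow> lam \<le> size {#b \<in># \<B>. x \<in> b \<and> y \<in> b#})"

text \<open>The point sets range over finite sets of natural numbers, which loses no generality:
  by \<open>is_covering_image\<close> any covering can be transported along a bijection of its points,
  so the minimum is also attained and a lower bound over every other type of points
  (\<open>covering_number_le\<close>). The value is meaningful only if some covering exists
  (\<open>is_covering_exists\<close>).\<close>

definition covering_number :: "nat \<Rightarrow> nat \<Rightarrow> nat \<Rightarrow> nat" where
  "covering_number lam v k =
     (LEAST n. \<exists>(V :: nat set) \<B>. is_covering v k lam V \<B> \<and> size \<B> = n)"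

lemma is_covering_image:
  assumes "is_covering v k lam V \<B>" and inj: "inj_on f V"
  shows "is_covering v k lam (f ` V) (image_mset ((`) f) \<B>)"
proof -
  have fin: "finite V" and cV: "card V = v"
    and blk: "\<And>b. b \<in># \<B> \<Longrightarrow> b \<subseteq> V \<and> card b = k"
    and pr: "\<And>x y. x \<in> V \<Longrightarrow> y \<in> V \<Longrightarrow> x \<noteq> y \<Longrightarrow> lam \<le> size {#b \<in># \<B>. x \<in> b \<and> y \<in> b#}"
    using assms(1) unfolding is_covering_def by auto
  have "card (f ` b) = k" if "b \<in># \<B>" for b
    using blk[OF that] inj card_image inj_on_subset by metis
  moreover have "lam \<le> size {#c \<in># image_mset ((`) f) \<B>. f x \<in> c \<and> f y \<in> c#}"
    if "x \<in> V" "y \<in> V" "f x \<noteq> f y" for x y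
  proof -
    have "{#b \<in># \<B>. f x \<in> f ` b \<and> f y \<in> f ` b#} = {#b \<in># \<B>. x \<in> b \<and> y \<in> b#}"
      by (rule filter_mset_cong) (use blk inj_on_image_mem_iff[OF inj] that in auto)
    then show ?thesis
      using pr[OF that(1,2)] that(3) by (auto simp: filter_mset_image_mset)
  qed
  ultimately show ?thesis
    unfolding is_covering_def using fin cV blk inj by (auto simp: card_image)
qed

lemma covering_number_le:
  assumes "is_covering v k lam V \<B>"
  shows "covering_number lam v k \<le> size \<B>"
proof -
  have "finite V" using assms unfolding is_covering_def by auto
  then obtain f :: "'a \<Rightarrow> nat" where "inj_on f V"
    using finite_imp_inj_to_nat_seg by blast
  from is_covering_image[OF assms this] show ?thesis
    unfolding covering_number_def by (intro Least_le exI conjI) auto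
qed

lemma is_covering_exists:
  assumes "2 \<le> k" and "k \<le> v" and "finite V" and "card V = v"
  shows "\<exists>\<B>. is_covering v k lam V \<B>"
proof -
  let ?S = "{b. b \<subseteq> V \<and> card b = k}"
  let ?B = "repeat_mset lam (mset_set ?S)"
  have finS: "finite ?S" using assms(3) by auto
  have "lam \<le> size {#b \<in># ?B. x \<in> b \<and> y \<in> b#}" if "x \<in> V" "y \<in> V" "x \<noteq> y" for x y
  proof -
    have "\<exists>b. {x, y} \<subseteq> b \<and> b \<subseteq> V \<and> card b = k"
      by (rule exists_subset_between) (use assms that in auto)
    then obtain b where "b \<in> ?S" "x \<in> b" "y \<in> b" by auto
    then have "lam = count {#b \<in># ?B. x \<in> b \<and> y \<in> b#} b"
      using finS by simp
    also have "\<dots> \<le> size {#b \<in># ?B. x \<in> b \<and> y \<in> b#}" by (rule count_le_size)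
    finally show ?thesis .
  qed
  moreover have "\<forall>b \<in># ?B. b \<subseteq> V \<and> card b = k"
    using finS by (auto simp: count_mset_set' simp flip: count_greater_zero_iff split: if_splits)
  ultimately show ?thesis using assms unfolding is_covering_def by blast
qed

lemma covering_number_attained:
  assumes "2 \<le> k" and "k \<le> v"
  shows "\<exists>(V :: nat set) \<B>. is_covering v k lam V \<B> \<and> size \<B> = covering_number lam v k"
proof -
  have "\<exists>n (V :: nat set) \<B>. is_covering v k lam V \<B> \<and> size \<B> = n"
    using is_covering_exists[OF assms, of "{..<v}" lam] by simp blast
  from LeastI_ex[OF this] show ?thesis unfolding covering_number_def .
qed

end

(*
  Every point lies in at least r blocks. Let W be the set of points lying in exactly r blocks.
  The Gram matrix of the incidence vectors of the points of W is lam J + E, where E is symmetric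
  with diagonal entries r - lam and nonnegative off-diagonal entries; as a point x of W has total
  excess r (k - 1) - lam (v - 1) = d < r - lam, E is strictly diagonally dominant. So the Gram
  matrix is positive definite, the incidence vectors are linearly independent, and card W is at
  most the number b of blocks. Counting incidences, b k >= (r + 1) v - card W >= (r + 1) v - b.
*)
theory Submission
  imports Defs
begin

text \<open>Gaussian elimination, by induction on the equations: a nonzero equation is solved for
  one unknown, which removes one equation and one unknown and so keeps the strict inequality of
  cardinalities.\<close>

lemma underdetermined_system_nontrivial_solution:
  fixes a :: "'i \<Rightarrow> 'x \<Rightarrow> 'f :: field"
  assumes "finite I" "finite W" "card I < card W"
  shows "\<exists>c. (\<exists>x\<in>W. c x \<noteq> 0) \<and> (\<forall>i\<in>I. (\<Sum>x\<in>W. a i x * c x) = 0)"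
  using assms
proof (induction I arbitrary: W a rule: finite_induct)
  case empty
  then obtain x where "x \<in> W" by fastforce
  then show ?case by (intro exI[of _ "\<lambda>_. 1"]) auto
next
  case (insert j I)
  show ?case
  proof (cases "\<forall>x\<in>W. a j x = 0")
    case True
    have "card I < card W" using insert by simp
    from insert.IH[OF insert.prems(1) this, of a] show ?thesis using True by auto
  next
    case False
    then obtain z where z: "z \<in> W" "a j z \<noteq> 0" by auto
    let ?W = "W - {z}"
    have "finite ?W" "card I < card ?W" using insert z by auto
    \<comment> \<open>These are the coefficients left after equation \<open>j\<close> is used to
      eliminate the unknown at \<open>z\<close>.\<close>
    from insert.IH[OF this, of "\<lambda>i x. a i x - a i z * a j x / a j z"]
    obtain c where c: "\<exists>x\<in>?W. c x \<noteq> 0"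
      "\<And>i. i \<in> I \<Longrightarrow> (\<Sum>x\<in>?W. (a i x - a i z * a j x / a j z) * c x) = 0" by blast
    \<comment> \<open>Back substitution: \<open>t\<close> is the value at \<open>z\<close> that
      makes equation \<open>j\<close> hold.\<close>
    define t where "t = - (\<Sum>x\<in>?W. a j x * c x) / a j z"
    define c' where "c' = c(z := t)"
    have split: "(\<Sum>x\<in>W. a i x * c' x) = a i z * t + (\<Sum>x\<in>?W. a i x * c x)" for i
    proof -
      have "(\<Sum>x\<in>W. a i x * c' x) = a i z * c' z + (\<Sum>x\<in>?W. a i x * c' x)"
        using insert.prems(1) z(1) by (rule sum.remove)
      then show ?thesis by (simp add: c'_def)
    qed
    have "(\<Sum>x\<in>W. a i x * c' x) = 0" if "i \<in> insert j I" for i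
    proof (cases "i = j")
      case True
      then show ?thesis using z by (simp add: split t_def)
    next
      case False
      have "(\<Sum>x\<in>?W. (a i x - a i z * a j x / a j z) * c x)
          = (\<Sum>x\<in>?W. a i x * c x) - (\<Sum>x\<in>?W. (a i z / a j z) * (a j x * c x))"
        by (simp add: sum_subtractf[symmetric] algebra_simps)
      also have "\<dots> = (\<Sum>x\<in>W. a i x * c' x)"
        unfolding split t_def sum_distrib_left[symmetric] by simp
      finally show ?thesis using c(2)[of i] that False by simp
    qed
    moreover have "\<exists>x\<in>W. c' x \<noteq> 0" using c(1) by (auto simp: c'_def)
    ultimately show ?thesis by blast
  qed
qed

text \<open>Each off-diagonal term \<open>e x y * c x * c y\<close> is at least minus
  \<open>\<bar>e x y\<bar>\<close> times the mean of the two squares. By symmetry these losses can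
  all be charged to \<open>(c x)\<^sup>2\<close>, where the diagonal entry outweighs them.\<close>

lemma diagonally_dominant_positive_definite:
  fixes e :: "'x \<Rightarrow> 'x \<Rightarrow> real"
  assumes fin: "finite W"
    and sym: "\<And>x y. x \<in> W \<Longrightarrow> y \<in> W \<Longrightarrow> e x y = e y x"
    and dom: "\<And>x. x \<in> W \<Longrightarrow> (\<Sum>y\<in>W - {x}. \<bar>e x y\<bar>) < e x x"
    and nz: "\<exists>x\<in>W. c x \<noteq> 0"
  shows "0 < (\<Sum>x\<in>W. \<Sum>y\<in>W. e x y * c x * c y)"
proof -
  have D: "W - {x} = {y. y \<in> W \<and> x \<noteq> y}" for x by auto
  have "(\<Sum>x\<in>W. \<Sum>y\<in>W - {x}. \<bar>e x y\<bar> * (c y)\<^sup>2) = (\<Sum>x\<in>W. \<Sum>y\<in>W - {x}. \<bar>e y x\<bar> * (c x)\<^sup>2)"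
    unfolding D using sum.swap_restrict[OF fin fin, of "\<lambda>x y. \<bar>e x y\<bar> * (c y)\<^sup>2" "\<lambda>x y. x \<noteq> y"]
    by (simp add: eq_commute)
  also have "\<dots> = (\<Sum>x\<in>W. \<Sum>y\<in>W - {x}. \<bar>e x y\<bar> * (c x)\<^sup>2)"
    using sym by (intro sum.cong) auto
  finally have swap: "(\<Sum>x\<in>W. \<Sum>y\<in>W - {x}. \<bar>e x y\<bar> * (c y)\<^sup>2)
    = (\<Sum>x\<in>W. \<Sum>y\<in>W - {x}. \<bar>e x y\<bar> * (c x)\<^sup>2)" .
  have amgm: "- (\<bar>e x y\<bar> * (c x)\<^sup>2 / 2 + \<bar>e x y\<bar> * (c y)\<^sup>2 / 2) \<le> e x y * c x * c y" for x y
  proof -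
    have "\<bar>c x * c y\<bar> \<le> ((c x)\<^sup>2 + (c y)\<^sup>2) / 2"
      using sum_squares_bound[of "\<bar>c x\<bar>" "\<bar>c y\<bar>"] by (simp add: abs_mult)
    then have "\<bar>e x y\<bar> * \<bar>c x * c y\<bar> \<le> \<bar>e x y\<bar> * (((c x)\<^sup>2 + (c y)\<^sup>2) / 2)"
      by (rule mult_left_mono) simp
    moreover have "- (\<bar>e x y\<bar> * \<bar>c x * c y\<bar>) \<le> e x y * c x * c y"
      by (simp add: abs_mult[symmetric] mult.assoc)
    ultimately show ?thesis by (simp add: field_simps)
  qed
  obtain z where z: "z \<in> W" "c z \<noteq> 0" using nz by blast
  \<comment> \<open>The sum of squares weighted by the dominance gaps is the lower bound to be
    reached; the chain below starts from it and ends at the quadratic form.\<close>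
  have "0 < (\<Sum>x\<in>W. (e x x - (\<Sum>y\<in>W - {x}. \<bar>e x y\<bar>)) * (c x)\<^sup>2)"
  proof (rule sum_pos2[OF fin z(1)])
    show "0 < (e z z - (\<Sum>y\<in>W - {z}. \<bar>e z y\<bar>)) * (c z)\<^sup>2"
      using dom z by (intro mult_pos_pos) auto
    show "0 \<le> (e x x - (\<Sum>y\<in>W - {x}. \<bar>e x y\<bar>)) * (c x)\<^sup>2" if "x \<in> W" for x
      using dom[OF that] by (intro mult_nonneg_nonneg) auto
  qed
  also have "\<dots> = (\<Sum>x\<in>W. e x x * (c x)\<^sup>2) - (\<Sum>x\<in>W. \<Sum>y\<in>W - {x}. \<bar>e x y\<bar> * (c x)\<^sup>2)"
    by (simp add: left_diff_distrib sum_subtractf sum_distrib_right)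
  \<comment> \<open>By \<open>swap\<close>, half of the loss may be moved from
    \<open>(c x)\<^sup>2\<close> to \<open>(c y)\<^sup>2\<close>, which gives the shape of
    \<open>amgm\<close>.\<close>
  also have "\<dots> = (\<Sum>x\<in>W. e x x * (c x)\<^sup>2)
      - (\<Sum>x\<in>W. \<Sum>y\<in>W - {x}. \<bar>e x y\<bar> * (c x)\<^sup>2 / 2 + \<bar>e x y\<bar> * (c y)\<^sup>2 / 2)"
    unfolding sum.distrib sum_divide_distrib[symmetric] swap by simp
  also have "\<dots> = (\<Sum>x\<in>W. e x x * (c x)\<^sup>2
      + (\<Sum>y\<in>W - {x}. - (\<bar>e x y\<bar> * (c x)\<^sup>2 / 2 + \<bar>e x y\<bar> * (c y)\<^sup>2 / 2)))"
    by (simp only: sum.distrib sum_negf diff_conv_add_uminus)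
  also have "\<dots> \<le> (\<Sum>x\<in>W. e x x * (c x)\<^sup>2 + (\<Sum>y\<in>W - {x}. e x y * c x * c y))"
    by (intro sum_mono add_left_mono amgm)
  also have "\<dots> = (\<Sum>x\<in>W. \<Sum>y\<in>W. e x y * c x * c y)"
    by (intro sum.cong refl)
      (simp add: sum.remove[OF fin] power2_eq_square mult.assoc)
  finally show ?thesis .
qed

lemma size_filter_mset_eq_sum:
  "int (size {#b \<in># mset bs. P b#}) = (\<Sum>i<length bs. of_bool (P (bs ! i)))"
proof -
  have "size {#b \<in># mset bs. P b#} = card {i. i < length bs \<and> P (bs ! i)}"
    by (metis length_filter_conv_card mset_filter size_mset)
  also have "\<dots> = card ({..<length bs} \<inter> {i. P (bs ! i)})"
    by (simp add: Int_def)
  finally show ?thesis by (simp add: sum.If_cases of_bool_def)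
qed

text \<open>The bound for a single covering, with the denominator cleared. Working in
  \<open>int\<close> keeps the subtractions exact.\<close>

lemma covering_size_bound:
  fixes r d :: int
  assumes cov: "is_covering v k lam V \<B>"
    and k: "2 \<le> k"
    and eq: "int lam * (int v - 1) = r * (int k - 1) - d"
    and d: "d < int k - 1" "d < r - int lam"
  shows "int v * (r + 1) \<le> int (size \<B>) * (int k + 1)"
proof -
  \<comment> \<open>Listing the blocks gives each copy of a repeated block its own index.\<close>
  obtain bs where bs: "\<B> = mset bs" by (metis ex_mset)
  let ?N = "length bs"
  \<comment> \<open>\<open>a\<close> is the block-point incidence matrix and \<open>m\<close> its
    Gram matrix: \<open>m x x\<close> is the number of blocks through \<open>x\<close>, and
    \<open>m x y\<close> the number through both points.\<close>
  define a :: "nat \<Rightarrow> 'a \<Rightarrow> int" where "a = (\<lambda>i x. of_bool (x \<in> bs ! i))"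
  define m where "m = (\<lambda>x y. \<Sum>i<?N. a i x * a i y)"
  have fin: "finite V" and cV: "card V = v" using cov by (auto simp: is_covering_def)
  have block: "bs ! i \<subseteq> V" "card (bs ! i) = k" if "i < ?N" for i
    using cov that by (auto simp: is_covering_def bs)
  have cover: "int lam \<le> m x y" if "x \<in> V" "y \<in> V" "x \<noteq> y" for x y
  proof -
    have "lam \<le> size {#b \<in># \<B>. x \<in> b \<and> y \<in> b#}" using cov that by (auto simp: is_covering_def)
    then have "int lam \<le> int (size {#b \<in># \<B>. x \<in> b \<and> y \<in> b#})" by simp
    also have "\<dots> = m x y"
      unfolding bs size_filter_mset_eq_sum m_def a_def by (simp add: of_bool_conj)
    finally show ?thesis .
  qed
  have m_diag: "m x x = (\<Sum>i<?N. a i x)" for x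
    unfolding m_def a_def by (intro sum.cong) auto
  have m_sym: "m x y = m y x" for x y unfolding m_def by (simp add: mult.commute)
  have block_sum: "(\<Sum>x\<in>V. a i x) = int k" if "i < ?N" for i
  proof -
    have "V \<inter> {x. x \<in> bs ! i} = bs ! i" using block(1)[OF that] by auto
    then show ?thesis using fin block(2)[OF that] by (simp add: a_def of_bool_def sum.If_cases)
  qed
  \<comment> \<open>Double counting: each block through \<open>x\<close> contains
    \<open>k - 1\<close> further points.\<close>
  have row_sum: "(\<Sum>y\<in>V - {x}. m x y) = m x x * (int k - 1)" if "x \<in> V" for x
  proof -
    have "(\<Sum>y\<in>V. m x y) = (\<Sum>i<?N. a i x * (\<Sum>y\<in>V. a i y))"
      unfolding m_def by (subst sum.swap) (simp add: sum_distrib_left)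
    also have "\<dots> = m x x * int k" by (simp add: block_sum m_diag sum_distrib_right)
    finally show ?thesis using sum.remove[OF fin that, of "m x"] by (simp add: algebra_simps)
  qed
  have excess: "(\<Sum>y\<in>V - {x}. m x y - int lam) = (m x x - r) * (int k - 1) + d" if "x \<in> V" for x
  proof -
    have "0 < v" using that fin cV by (metis card_gt_0_iff empty_iff)
    then have "int (v - 1) = int v - 1" by simp
    then have "(\<Sum>y\<in>V - {x}. m x y - int lam) = m x x * (int k - 1) - int lam * (int v - 1)"
      using fin that cV by (simp add: sum_subtractf row_sum)
    then show ?thesis using eq by (simp add: algebra_simps)
  qed
  have r_le: "r \<le> m x x" if "x \<in> V" for x
  proof (rule ccontr)
    assume "\<not> r \<le> m x x"
    \<comment> \<open>With at most \<open>r - 1\<close> blocks through \<open>x\<close>, the total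
      excess would be at most \<open>d - (k - 1) < 0\<close>, although every summand is
      nonnegative.\<close>
    then have "(m x x - r) * (int k - 1) \<le> - 1 * (int k - 1)"
      using k by (intro mult_right_mono) auto
    moreover have "0 \<le> (\<Sum>y\<in>V - {x}. m x y - int lam)"
      using cover that by (intro sum_nonneg) auto
    ultimately show False using excess[OF that] d(1) by simp
  qed

  define W where "W = {x \<in> V. m x x = r}"
  have W: "finite W" "W \<subseteq> V" using fin by (auto simp: W_def)
  have "card W \<le> ?N"
  proof (rule ccontr)
    assume "\<not> card W \<le> ?N"
    \<comment> \<open>More points than blocks: the incidence vectors of the points of
      \<open>W\<close> satisfy a nontrivial linear relation \<open>c\<close>.\<close>
    then obtain c :: "'a \<Rightarrow> real" where c: "\<exists>x\<in>W. c x \<noteq> 0"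
      "\<And>i. i < ?N \<Longrightarrow> (\<Sum>x\<in>W. of_int (a i x) * c x) = 0"
      using underdetermined_system_nontrivial_solution
        [of "{..<?N}" W "\<lambda>i x. of_int (a i x)"] W by auto
    define e :: "'a \<Rightarrow> 'a \<Rightarrow> real" where "e = (\<lambda>x y. of_int (m x y - int lam))"
    have "0 < (\<Sum>x\<in>W. \<Sum>y\<in>W. e x y * c x * c y)"
    proof (rule diagonally_dominant_positive_definite[OF W(1) _ _ c(1)])
      show "e x y = e y x" for x y by (simp add: e_def m_sym)
      show "(\<Sum>y\<in>W - {x}. \<bar>e x y\<bar>) < e x x" if x: "x \<in> W" for x
      proof -
        have "(\<Sum>y\<in>W - {x}. \<bar>m x y - int lam\<bar>) = (\<Sum>y\<in>W - {x}. m x y - int lam)"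
        proof (rule sum.cong[OF refl])
          show "\<bar>m x y - int lam\<bar> = m x y - int lam" if "y \<in> W - {x}" for y
          proof -
            have "int lam \<le> m x y" using cover W(2) x that by blast
            then show ?thesis by simp
          qed
        qed
        \<comment> \<open>The points outside \<open>W\<close> only add nonnegative excess, and the
          full sum is exactly \<open>d\<close> because \<open>m x x = r\<close>.\<close>
        also have "\<dots> \<le> (\<Sum>y\<in>V - {x}. m x y - int lam)"
          using W(2) x fin by (intro sum_mono2) (use cover in auto)
        also have "\<dots> < m x x - int lam" using excess[of x] x d by (simp add: W_def)
        finally have "real_of_int (\<Sum>y\<in>W - {x}. \<bar>m x y - int lam\<bar>) < real_of_int (m x x - int lam)"
          by (simp only: of_int_less_iff)
        then show ?thesis by (simp add: e_def)
      qed
    qed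
    \<comment> \<open>The added square is the quadratic form of \<open>lam\<close> times the
      all-ones matrix, which turns \<open>e\<close> back into \<open>m\<close>.\<close>
    also have "\<dots> \<le> (\<Sum>x\<in>W. \<Sum>y\<in>W. e x y * c x * c y) + real lam * (\<Sum>x\<in>W. c x)\<^sup>2" by simp
    also have "\<dots> = (\<Sum>x\<in>W. \<Sum>y\<in>W. real_of_int (m x y) * c x * c y)"
      unfolding e_def power2_eq_square sum_product
      by (simp add: sum_distrib_left sum.distrib[symmetric] algebra_simps)
    \<comment> \<open>The Gram form is a sum of squares, one for each block, and the choice of
      \<open>c\<close> makes every one of them vanish.\<close>
    also have "\<dots> = (\<Sum>x\<in>W. \<Sum>y\<in>W. \<Sum>i<?N. (of_int (a i x) * c x) * (of_int (a i y) * c y))"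
      unfolding m_def by (simp add: sum_distrib_left sum_distrib_right algebra_simps)
    also have "\<dots> = (\<Sum>x\<in>W. \<Sum>i<?N. \<Sum>y\<in>W. (of_int (a i x) * c x) * (of_int (a i y) * c y))"
      by (intro sum.cong refl sum.swap)
    also have "\<dots> = (\<Sum>i<?N. \<Sum>x\<in>W. \<Sum>y\<in>W. (of_int (a i x) * c x) * (of_int (a i y) * c y))"
      by (rule sum.swap)
    also have "\<dots> = (\<Sum>i<?N. (\<Sum>x\<in>W. of_int (a i x) * c x)\<^sup>2)"
      by (simp add: power2_eq_square sum_product)
    also have "\<dots> = 0" using c(2) by simp
    finally show False by simp
  qed
  moreover have "int v * (r + 1) - int (card W) \<le> int ?N * int k"
  proof -
    \<comment> \<open>Points of \<open>W\<close> lie in \<open>r\<close> blocks and all others in at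
      least \<open>r + 1\<close>; the incidences are then counted by blocks.\<close>
    have "int v * (r + 1) - int (card W) = (\<Sum>x\<in>V. (r + 1) - of_bool (m x x = r))"
      using fin cV by (simp add: sum_subtractf W_def of_bool_def sum.If_cases Int_def)
    also have "\<dots> \<le> (\<Sum>x\<in>V. m x x)"
    proof (rule sum_mono)
      show "r + 1 - of_bool (m x x = r) \<le> m x x" if "x \<in> V" for x
        using r_le[OF that] by auto
    qed
    also have "\<dots> = (\<Sum>i<?N. \<Sum>x\<in>V. a i x)" unfolding m_diag by (rule sum.swap)
    also have "\<dots> = int ?N * int k" by (simp add: block_sum)
    finally show ?thesis .
  qed
  ultimately show ?thesis by (simp add: bs algebra_simps)
qed

theorem theorem1p1:
  fixes v k lam :: nat and r d :: int
  assumes "0 < v" and "0 < k" and "0 < lam"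
    and "3 \<le> k" and "k < v"
    and "int lam * (int v - 1) = r * (int k - 1) - d"
    and "0 \<le> d" and "d < int k - 1"
    and "d < r - int lam"
  shows "int (covering_number lam v k) \<ge> \<lceil>real_of_int (int v * (r + 1)) / real (k + 1)\<rceil>"
proof -
  \<comment> \<open>A covering of minimum size exists, so the bound for single coverings applies to
    the covering number itself.\<close>
  obtain V :: "nat set" and \<B> where cov: "is_covering v k lam V \<B>"
    and size: "size \<B> = covering_number lam v k"
    using covering_number_attained[of k v lam] assms by auto
  have "int v * (r + 1) \<le> int (covering_number lam v k * (k + 1))"
    using covering_size_bound[OF cov _ assms(6,8,9)] assms(4) size by (simp add: algebra_simps)
  then have "real_of_int (int v * (r + 1)) \<le> real_of_int (int (covering_number lam v k * (k + 1)))"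
    by (simp only: of_int_le_iff)
  then have "real_of_int (int v * (r + 1)) \<le> real (covering_number lam v k) * real (k + 1)"
    by (metis of_int_of_nat_eq of_nat_mult)
  then show ?thesis by (simp add: ceiling_le_iff pos_divide_le_eq)
qed

end
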